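(* Let $f$ be any one of the following 6 degree-based topological indices: Forgotten, InvDeg, Zagreb1, lnZagreb2, lnZagreb3, mZagreb. Then the set of chemical graphs that are extremal for $f$ is exactly $F_1\cup F_3\cup F_5$.
   Context: All graphs are finite, simple and undirected. A chemical graph is a connected graph of order (number of vertices) $n\ge 7$, size (number of edges) $m\le \frac{3n-3}{2}$ and maximum degree at most $3$. For such a graph, $x_{ij}$ ($i\le j$) denotes the number of $(i,j)$-edges, i.e. edges whose endpoints have degrees $i$ and $j$ (necessarily $x_{11}=0$). A degree-based topological index is a function of the form $f(G)=c_{12}x_{12}+c_{13}x_{13}+c_{22}x_{22}+c_{23}x_{23}+c_{33}x_{33}$ with real coefficients $c_{ij}$. A chemical graph $G$ is extremal for $f$ if it maximizes $f$ or minimizes $f$ over all chemical graphs of the same order and size as $G$. The indices are given by the following coefficients $c_{ij}$: - Forgotten: $i^2+j^2$; - InvDeg: $i^{-2}+j^{-2}$; - Zagreb1: $i+j$; - lnZagreb2: $2\left(\frac{\ln i}{i}+\frac{\ln j}{j}\right)$; - lnZagreb3: $\ln i+\ln j$; - mZagreb: $i^{-3}+j^{-3}$. $F_1$ is the set of chemical graphs (of order $n$ and size $m$) with $(x_{12},x_{13},x_{22},x_{23},x_{33})$ equal to - $\left(0,\frac{3n-2m}{2},0,0,\frac{4m-3n}{2}\right)$ if $n$ is even; - $\left(0,\frac{3n-2m-1}{2},0,2,\frac{4m-3n-3}{2}\right)$ if $n$ is odd. $F_3$ is the set of chemical graphs with $(x_{12},x_{13},x_{22},x_{23},x_{33})$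 equal to - $\left(0,\frac{3n-2m}{2},0,0,\frac{4m-3n}{2}\right)$ if $n$ is even; - $\left(1,\frac{3n-2m-3}{2},0,1,\frac{4m-3n-1}{2}\right)$ if $n$ is odd. $F_5$ is the set of chemical graphs with $(x_{12},x_{13},x_{22},x_{23},x_{33})$ equal to - $(2,0,m-2,0,0)$ if $m=n-1$; - $(0,0,m,0,0)$ if $m=n$; - $(0,0,m-6,6,0)$ or $(0,0,m-5,4,1)$ if $m=n+1$; - $(0,0,a,6n-4m-2a,5m-6n+a)$ if $n+1<m\le\frac{3n-3}{2}$, where $a$ is any integer such that $\max\{0,6n-5m\}\le a\le 3n-2m-1$. *)

theory Defs
  imports Complex_Main "Graph_Theory.Graph_Theory"
begin

text \<open>
  A finite simple undirected graph is a \<open>pair_graph\<close>: a finite loop-free symmetric digraph without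
  parallel arcs. Every undirected edge \<open>{u, v}\<close> is represented by the two arcs \<open>(u, v)\<close> and
  \<open>(v, u)\<close>, so edges are counted through \<open>uedges\<close>, while the degree of a vertex is its out-degree.
\<close>

definition uedges :: "'a pair_pre_digraph \<Rightarrow> 'a set set" where
  "uedges G = (\<lambda>(u, v). {u, v}) ` parcs G"

definition graph_order :: "'a pair_pre_digraph \<Rightarrow> nat" where
  "graph_order G = card (pverts G)"

definition graph_size :: "'a pair_pre_digraph \<Rightarrow> nat" where
  "graph_size G = card (uedges G)"

definition degree :: "'a pair_pre_digraph \<Rightarrow> 'a \<Rightarrow> nat" where
  "degree G v = out_degree (with_proj G) v"

definition chemical_graph :: "'a pair_pre_digraph \<Rightarrow> bool" where
  "chemical_graph G \<longleftrightarrow>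
     pair_graph G \<and> connected (with_proj G) \<and>
     graph_order G \<ge> 7 \<and>
     real (graph_size G) \<le> (3 * real (graph_order G) - 3) / 2 \<and>
     (\<forall>v \<in> pverts G. degree G v \<le> 3)"

definition edge_count :: "'a pair_pre_digraph \<Rightarrow> nat \<Rightarrow> nat \<Rightarrow> nat" where
  "edge_count G i j =
     card {e \<in> uedges G. \<exists>u v. e = {u, v} \<and> degree G u = i \<and> degree G v = j}"

definition topological_index :: "(nat \<Rightarrow> nat \<Rightarrow> real) \<Rightarrow> 'a pair_pre_digraph \<Rightarrow> real" where
  "topological_index c G =
     c 1 2 * real (edge_count G 1 2) + c 1 3 * real (edge_count G 1 3) +
     c 2 2 * real (edge_count G 2 2) + c 2 3 * real (edge_count G 2 3) +
     c 3 3 * real (edge_count G 3 3)"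

text \<open>
  The competitors \<open>H\<close> range over the same vertex type as \<open>G\<close>. This is no restriction: they have as
  many vertices as \<open>G\<close>, so each has an isomorphic copy on the vertex set of \<open>G\<close>.
\<close>

definition extremal :: "('a pair_pre_digraph \<Rightarrow> real) \<Rightarrow> 'a pair_pre_digraph \<Rightarrow> bool" where
  "extremal f G \<longleftrightarrow> chemical_graph G \<and>
     ((\<forall>H. chemical_graph H \<and> graph_order H = graph_order G \<and> graph_size H = graph_size G
           \<longrightarrow> f H \<le> f G) \<or>
      (\<forall>H. chemical_graph H \<and> graph_order H = graph_order G \<and> graph_size H = graph_size G
           \<longrightarrow> f G \<le> f H))"

definition forgotten :: "nat \<Rightarrow> nat \<Rightarrow> real" where
  "forgotten i j = real i ^ 2 + real j ^ 2"

definition inv_deg :: "nat \<Rightarrow> nat \<Rightarrow> real" where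
  "inv_deg i j = 1 / real i ^ 2 + 1 / real j ^ 2"

definition zagreb1 :: "nat \<Rightarrow> nat \<Rightarrow> real" where
  "zagreb1 i j = real i + real j"

definition ln_zagreb2 :: "nat \<Rightarrow> nat \<Rightarrow> real" where
  "ln_zagreb2 i j = 2 * (ln (real i) / real i + ln (real j) / real j)"

definition ln_zagreb3 :: "nat \<Rightarrow> nat \<Rightarrow> real" where
  "ln_zagreb3 i j = ln (real i) + ln (real j)"

definition m_zagreb :: "nat \<Rightarrow> nat \<Rightarrow> real" where
  "m_zagreb i j = 1 / real i ^ 3 + 1 / real j ^ 3"

text \<open>
  The vector \<open>(x12, x13, x22, x23, x33)\<close>, taken over the reals so that the subtractions and
  halvings below are the usual ones.
\<close>

definition edge_vector :: "'a pair_pre_digraph \<Rightarrow> real \<times> real \<times> real \<times> real \<times> real" where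
  "edge_vector G =
     (real (edge_count G 1 2), real (edge_count G 1 3), real (edge_count G 2 2),
      real (edge_count G 2 3), real (edge_count G 3 3))"

definition F1 :: "'a pair_pre_digraph set" where
  "F1 = {G. chemical_graph G \<and>
     (let n = real (graph_order G); m = real (graph_size G) in
        edge_vector G =
          (if even (graph_order G)
           then (0, (3 * n - 2 * m) / 2, 0, 0, (4 * m - 3 * n) / 2)
           else (0, (3 * n - 2 * m - 1) / 2, 0, 2, (4 * m - 3 * n - 3) / 2)))}"

definition F3 :: "'a pair_pre_digraph set" where
  "F3 = {G. chemical_graph G \<and>
     (let n = real (graph_order G); m = real (graph_size G) in
        edge_vector G =
          (if even (graph_order G)
           then (0, (3 * n - 2 * m) / 2, 0, 0, (4 * m - 3 * n) / 2)
           else (1, (3 * n - 2 * m - 3) / 2, 0, 1, (4 * m - 3 * n - 1) / 2)))}"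

definition F5 :: "'a pair_pre_digraph set" where
  "F5 = {G. chemical_graph G \<and>
     (let n = real (graph_order G); m = real (graph_size G) in
        (m = n - 1 \<and> edge_vector G = (2, 0, m - 2, 0, 0)) \<or>
        (m = n \<and> edge_vector G = (0, 0, m, 0, 0)) \<or>
        (m = n + 1 \<and>
           (edge_vector G = (0, 0, m - 6, 6, 0) \<or> edge_vector G = (0, 0, m - 5, 4, 1))) \<or>
        (n + 1 < m \<and> m \<le> (3 * n - 3) / 2 \<and>
           (\<exists>a :: int. max 0 (6 * n - 5 * m) \<le> real_of_int a \<and>
              real_of_int a \<le> 3 * n - 2 * m - 1 \<and>
              edge_vector G =
                (0, 0, real_of_int a, 6 * n - 4 * m - 2 * real_of_int a,
                 5 * m - 6 * n + real_of_int a))))}"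

end

theory Submission
  imports Defs
begin

text \<open>
  In each of the six indices the coefficient of an edge splits as \<open>g i + g j\<close>, so the index is the sum of
  \<open>d * g d\<close> over the degrees \<open>d\<close> of all vertices and depends only on the numbers \<open>n1, n2, n3\<close> of vertices of
  degree \<open>1, 2, 3\<close>. Order and size impose \<open>n1 + n2 + n3 = n\<close> and \<open>n1 + 2 * n2 + 3 * n3 = 2 * m\<close>, which
  leaves one parameter, the number of leaves \<open>n1\<close>. The index is an affine function of it whose slope, the
  second difference of \<open>d * g d\<close> at \<open>d = 2\<close>, is not zero (\<open>index_vertex_weights\<close>). Hence the extremal
  graphs are those with the most leaves and those with the fewest (\<open>extremal_iff_leaf_count\<close>).

  Since \<open>3 * n - 2 * m = n2 + 2 * n1\<close>, having the most leaves means having the fewest vertices of degree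
  \<open>2\<close>, and parity allows \<open>n2 = 0\<close> only for even \<open>n\<close>. A caterpillar with chords shows that \<open>n2 \<le> 1\<close> can
  always be reached (\<open>exists_few_degree_2\<close>). At the other end, a Hamiltonian path with nested chords has no
  leaves, or is a path if the size is that of a tree (\<open>exists_few_leaves\<close>).

  It remains to translate both conditions into edge vectors. Counting edge ends by degree gives
  \<open>n1 = x12 + x13\<close>, \<open>2 * n2 = x12 + 2 * x22 + x23\<close> and \<open>3 * n3 = x13 + x23 + 2 * x33\<close>
  (\<open>chemical_graph_counts\<close>). The solutions of these equations that are not realized by a connected
  simple graph are excluded by hand, and what is left is \<open>F1 \<union> F3\<close> for the most leaves (\<open>F1_F3_iff\<close>)
  and \<open>F5\<close> for the fewest (\<open>F5_iff\<close>).
\<close>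

section \<open>Counting vertices and edges by degree\<close>

definition vertex_count :: "'a pair_pre_digraph \<Rightarrow> nat \<Rightarrow> nat" where
  "vertex_count G d = card {v \<in> pverts G. degree G v = d}"

definition arcs_between :: "'a pair_pre_digraph \<Rightarrow> nat \<Rightarrow> nat \<Rightarrow> ('a \<times> 'a) set" where
  "arcs_between G i j = {(u, v) \<in> parcs G. degree G u = i \<and> degree G v = j}"

text \<open>
  The bridge between edges and arcs: every edge has exactly two orientations.
\<close>

lemma card_symmetric_arcs:
  assumes "finite S" "sym S" "irrefl S"
  shows "card S = 2 * card ((\<lambda>(u, v). {u, v}) ` S)"
proof -
  let ?\<pi> = "\<lambda>(u, v). {u, v}"
  have fibre: "card {a \<in> S. ?\<pi> a = e} = 2" if "e \<in> ?\<pi> ` S" for e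
  proof -
    from that obtain u v where uv: "(u, v) \<in> S" "e = {u, v}" by auto
    with assms have "(v, u) \<in> S" "u \<noteq> v" by (auto dest: symD simp: irrefl_def)
    with uv have "{a \<in> S. ?\<pi> a = e} = {(u, v), (v, u)}"
      by (auto simp: doubleton_eq_iff)
    with \<open>u \<noteq> v\<close> show ?thesis by simp
  qed
  have "card S = (\<Sum>a\<in>S. 1)" by simp
  also have "\<dots> = (\<Sum>e\<in>?\<pi> ` S. \<Sum>a\<in>{a \<in> S. ?\<pi> a = e}. 1)"
    by (rule sum.image_gen) (fact assms(1))
  also have "\<dots> = (\<Sum>e\<in>?\<pi> ` S. 2)"
    by (rule sum.cong) (use fibre in simp_all)
  finally show ?thesis by simp
qed

lemma degree_eq_card: "degree G v = card {w. (v, w) \<in> parcs G}"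
proof -
  have "out_arcs (with_proj G) v = Pair v ` {w. (v, w) \<in> parcs G}"
    by (auto simp: out_arcs_def)
  then show ?thesis
    by (simp add: degree_def out_degree_def card_image inj_on_def)
qed

lemma pair_graph_arcs:
  assumes "pair_graph G"
  shows "finite (pverts G)" "finite (parcs G)" "parcs G \<subseteq> pverts G \<times> pverts G"
    "sym (parcs G)" "irrefl (parcs G)"
proof -
  interpret pair_graph G by fact
  show "finite (pverts G)" "finite (parcs G)" by simp_all
  show "parcs G \<subseteq> pverts G \<times> pverts G" by (auto dest: in_arcsD1 in_arcsD2)
  show "sym (parcs G)" by (auto intro: symI arcs_symmetric)
  show "irrefl (parcs G)" by (auto simp: irrefl_def dest: no_loops')
qed

lemma pair_graph_connected_iff:
  assumes "pair_graph G"
  shows "connected (with_proj G) \<longleftrightarrow>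
    pverts G \<noteq> {} \<and> (\<forall>u\<in>pverts G. \<forall>v\<in>pverts G. (u, v) \<in> (parcs G)\<^sup>*)"
proof -
  interpret pair_graph G by fact
  have arcs: "parcs (mk_symmetric (with_proj G)) = parcs G"
    using adj_mk_symmetric_eq sym_arcs by simp
  have "u \<rightarrow>\<^sup>*\<^bsub>with_proj (mk_symmetric (with_proj G))\<^esub> v \<longleftrightarrow> (u, v) \<in> (parcs G)\<^sup>*"
    if "u \<in> pverts G" "v \<in> pverts G" for u v
  proof -
    have "u \<rightarrow>\<^sup>*\<^bsub>with_proj (mk_symmetric (with_proj G))\<^esub> v \<longleftrightarrow> u \<rightarrow>\<^sup>*\<^bsub>with_proj G\<^esub> v"
      using reachable_mk_symmetric_eq sym_arcs by blast
    also have "\<dots> \<longleftrightarrow> (u, v) \<in> (parcs G)\<^sup>*"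
      using reachable_conv that by simp
    finally show ?thesis .
  qed
  then show ?thesis
    by (simp add: connected_def strongly_connected_def)
qed

text \<open>
  The form in which connectedness is used to forbid small configurations: such a configuration
  would be a component of its own.
\<close>

lemma connected_closed_subset:
  assumes "pair_graph G" "connected (with_proj G)"
    and "u \<in> S" "u \<in> pverts G"
    and closed: "\<And>v w. v \<in> S \<Longrightarrow> (v, w) \<in> parcs G \<Longrightarrow> w \<in> S"
  shows "pverts G \<subseteq> S"
proof
  fix v assume "v \<in> pverts G"
  with assms have "(u, v) \<in> (parcs G)\<^sup>*" by (simp add: pair_graph_connected_iff)
  then show "v \<in> S"
    by induction (use \<open>u \<in> S\<close> closed in auto)
qed

text \<open>
  Fix a root \<open>r\<close>. Every other vertex has a neighbour that is closer to \<open>r\<close>, and the edge to that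
  neighbour determines the vertex as its farther end. So the vertices other than \<open>r\<close> inject into the
  edges.
\<close>

lemma connected_size_ge:
  assumes "pair_graph G" "connected (with_proj G)"
  shows "graph_order G \<le> graph_size G + 1"
proof -
  note arcs = pair_graph_arcs[OF assms(1)]
  let ?R = "parcs G"
  from assms obtain r where r: "r \<in> pverts G"
    by (auto simp: pair_graph_connected_iff)
  define dist where "dist v = (LEAST d. (r, v) \<in> ?R ^^ d)" for v
  have dist_le: "dist v \<le> d" if "(r, v) \<in> ?R ^^ d" for v d
    unfolding dist_def using that by (rule Least_le)
  have reach: "(r, v) \<in> ?R ^^ dist v" if v: "v \<in> pverts G" for v
  proof -
    have "(r, v) \<in> ?R\<^sup>*" using assms r v by (simp add: pair_graph_connected_iff)
    then obtain d where "(r, v) \<in> ?R ^^ d" by (auto simp: rtrancl_power)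
    then show ?thesis unfolding dist_def by (rule LeastI)
  qed
  have "\<exists>u. (u, v) \<in> ?R \<and> dist u < dist v" if v: "v \<in> pverts G - {r}" for v
  proof (cases "dist v")
    case 0
    with reach[of v] v show ?thesis by simp
  next
    case (Suc d)
    with reach[of v] v obtain u where "(r, u) \<in> ?R ^^ d" "(u, v) \<in> ?R" by auto
    with dist_le[of u d] Suc show ?thesis by auto
  qed
  then obtain p where p: "\<And>v. v \<in> pverts G - {r} \<Longrightarrow> (p v, v) \<in> ?R \<and> dist (p v) < dist v"
    by metis
  have "inj_on (\<lambda>v. {p v, v}) (pverts G - {r})"
    by (rule inj_onI) (metis doubleton_eq_iff p less_asym)
  moreover have "(\<lambda>v. {p v, v}) ` (pverts G - {r}) \<subseteq> uedges G"
    using p by (force simp: uedges_def)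
  moreover have "finite (uedges G)" using arcs by (simp add: uedges_def)
  ultimately have "card (pverts G - {r}) \<le> card (uedges G)" by (rule card_inj_on_le)
  then show ?thesis using r arcs by (simp add: graph_order_def graph_size_def)
qed

lemma edge_count_eq_card_image:
  assumes "pair_graph G"
  shows "edge_count G i j = card ((\<lambda>(u, v). {u, v}) ` arcs_between G i j)"
proof -
  have "sym (parcs G)" using assms by (rule pair_graph_arcs)
  then have "{e \<in> uedges G. \<exists>u v. e = {u, v} \<and> degree G u = i \<and> degree G v = j} =
    (\<lambda>(u, v). {u, v}) ` arcs_between G i j"
    unfolding uedges_def arcs_between_def
    by (fastforce simp: doubleton_eq_iff dest: symD)
  then show ?thesis by (simp add: edge_count_def)
qed

lemma card_arcs_between_same:
  assumes "pair_graph G"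
  shows "card (arcs_between G i i) = 2 * edge_count G i i"
  unfolding edge_count_eq_card_image[OF assms]
  using pair_graph_arcs[OF assms]
  by (intro card_symmetric_arcs)
    (auto simp: arcs_between_def sym_def irrefl_def intro: finite_subset)

lemma card_arcs_between_distinct:
  assumes "pair_graph G" "i \<noteq> j"
  shows "card (arcs_between G i j) = edge_count G i j"
    and "card (arcs_between G j i) = edge_count G i j"
proof -
  have sym: "sym (parcs G)" using assms(1) by (rule pair_graph_arcs)
  have "inj_on (\<lambda>(u, v). {u, v}) (arcs_between G i j)"
    using assms(2) by (auto simp: inj_on_def arcs_between_def doubleton_eq_iff)
  then show 1: "card (arcs_between G i j) = edge_count G i j"
    by (simp add: edge_count_eq_card_image[OF assms(1)] card_image)
  have "arcs_between G j i = prod.swap ` arcs_between G i j"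
    using sym by (auto simp: arcs_between_def image_iff dest: symD)
  then show "card (arcs_between G j i) = edge_count G i j"
    using 1 by (simp add: card_image)
qed

text \<open>
  The vertices of one degree span at most as many edges as a complete graph does. This is needed for
  classes of one or two vertices, where the bound is \<open>0\<close> or \<open>1\<close>.
\<close>

lemma edge_count_same_le:
  assumes "pair_graph G"
  shows "2 * edge_count G d d \<le> vertex_count G d * (vertex_count G d - 1)"
proof -
  let ?V = "{v \<in> pverts G. degree G v = d}"
  note arcs = pair_graph_arcs[OF assms]
  have fin: "finite ?V" using arcs by simp
  have "arcs_between G d d \<subseteq> (SIGMA u:?V. ?V - {u})"
    using arcs by (auto simp: arcs_between_def irrefl_def)
  then have "card (arcs_between G d d) \<le> card (SIGMA u:?V. ?V - {u})"
    using fin by (intro card_mono) auto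
  also have "\<dots> = vertex_count G d * (vertex_count G d - 1)"
    using fin by (subst card_SigmaI) (auto simp: vertex_count_def)
  finally show ?thesis by (simp add: card_arcs_between_same[OF assms])
qed

lemma chemical_graph_degree:
  assumes "chemical_graph G" "v \<in> pverts G"
  shows "degree G v \<in> {1, 2, 3}"
proof -
  have G: "pair_graph G" "connected (with_proj G)" and "graph_order G \<ge> 7" "degree G v \<le> 3"
    using assms by (auto simp: chemical_graph_def)
  note arcs = pair_graph_arcs[OF G(1)]
  have "degree G v \<noteq> 0"
  proof
    assume "degree G v = 0"
    moreover have "finite {w. (v, w) \<in> parcs G}"
      using arcs by (auto intro!: finite_subset[of _ "pverts G"])
    ultimately have "{w. (v, w) \<in> parcs G} = {}" by (simp add: degree_eq_card)
    then have "pverts G \<subseteq> {v}"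
      using connected_closed_subset[OF G, of v "{v}"] assms(2) by auto
    then have "graph_order G \<le> 1"
      unfolding graph_order_def using card_mono[of "{v}"] by auto
    with \<open>graph_order G \<ge> 7\<close> show False by simp
  qed
  with \<open>degree G v \<le> 3\<close> show ?thesis by auto
qed

lemma chemical_graph_no_11_edge:
  assumes "chemical_graph G"
  shows "arcs_between G 1 1 = {}"
proof (rule ccontr)
  have G: "pair_graph G" "connected (with_proj G)" and ge: "graph_order G \<ge> 7"
    using assms by (auto simp: chemical_graph_def)
  note arcs = pair_graph_arcs[OF G(1)]
  assume "arcs_between G 1 1 \<noteq> {}"
  then obtain u v where uv: "(u, v) \<in> parcs G" "degree G u = 1" "degree G v = 1"
    by (auto simp: arcs_between_def)
  then have vu: "(v, u) \<in> parcs G" using arcs by (auto dest: symD)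
  from uv vu have "{w. (u, w) \<in> parcs G} = {v}" "{w. (v, w) \<in> parcs G} = {u}"
    by (auto simp: degree_eq_card card_1_singleton_iff set_eq_iff)
  then have "pverts G \<subseteq> {u, v}"
    using connected_closed_subset[OF G, of u "{u, v}"] uv arcs by auto
  then have "graph_order G \<le> card {u, v}"
    unfolding graph_order_def by (intro card_mono) auto
  also have "\<dots> \<le> 2" by (simp add: card_insert_if)
  finally show False using ge by simp
qed

text \<open>
  Counting the arcs that leave the vertices of degree \<open>d\<close>, once by their tails and once by the
  degrees of their heads, gives one equation for each \<open>d\<close>; all arcs together give the handshake
  identity.
\<close>

lemma chemical_graph_counts:
  assumes "chemical_graph G"
  shows "vertex_count G 1 + vertex_count G 2 + vertex_count G 3 = graph_order G"
    and "vertex_count G 1 = edge_count G 1 2 + edge_count G 1 3"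
    and "2 * vertex_count G 2 = edge_count G 1 2 + 2 * edge_count G 2 2 + edge_count G 2 3"
    and "3 * vertex_count G 3 = edge_count G 1 3 + edge_count G 2 3 + 2 * edge_count G 3 3"
    and "2 * graph_size G = vertex_count G 1 + 2 * vertex_count G 2 + 3 * vertex_count G 3"
proof -
  have G: "pair_graph G" using assms by (simp add: chemical_graph_def)
  note arcs = pair_graph_arcs[OF G]
  let ?V = "\<lambda>d. {v \<in> pverts G. degree G v = d}"
  let ?N = "\<lambda>v. {w. (v, w) \<in> parcs G}"
  have finV: "finite (?V d)" for d using arcs by simp
  have finN: "finite (?N v)" for v
    using arcs by (auto intro!: finite_subset[of _ "pverts G"])
  have deg: "degree G v \<in> {1, 2, 3}" if "v \<in> pverts G" for v
    using assms that by (rule chemical_graph_degree)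
  have split: "pverts G = ?V 1 \<union> ?V 2 \<union> ?V 3" using deg by fastforce
  have "card (pverts G) = card (?V 1) + card (?V 2) + card (?V 3)"
    by (subst split, subst card_Un_disjoint, use finV in auto)
       (subst card_Un_disjoint, use finV in auto)
  then show "vertex_count G 1 + vertex_count G 2 + vertex_count G 3 = graph_order G"
    by (simp add: vertex_count_def graph_order_def)
  have sum_deg: "card (Sigma (?V d) ?N) = d * vertex_count G d" for d
    using finV finN by (subst card_SigmaI) (auto simp: vertex_count_def degree_eq_card)
  have out: "d * vertex_count G d =
    card (arcs_between G d 1) + card (arcs_between G d 2) + card (arcs_between G d 3)" for d
  proof -
    have fin: "finite (arcs_between G d j)" for j
      using arcs(2) by (rule finite_subset[rotated]) (auto simp: arcs_between_def)
    have "Sigma (?V d) ?N = arcs_between G d 1 \<union> arcs_between G d 2 \<union> arcs_between G d 3"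
      using arcs(3) deg by (fastforce simp: arcs_between_def)
    moreover have "card (arcs_between G d 1 \<union> arcs_between G d 2 \<union> arcs_between G d 3) =
      card (arcs_between G d 1) + card (arcs_between G d 2) + card (arcs_between G d 3)"
      using fin by (subst card_Un_disjoint; (subst card_Un_disjoint)?) (auto simp: arcs_between_def)
    ultimately show ?thesis using sum_deg[of d] by simp
  qed
  note [simp del] = One_nat_def
  show "vertex_count G 1 = edge_count G 1 2 + edge_count G 1 3"
    using out[of 1] chemical_graph_no_11_edge[OF assms] card_arcs_between_distinct[OF G]
    by simp
  show "2 * vertex_count G 2 = edge_count G 1 2 + 2 * edge_count G 2 2 + edge_count G 2 3"
    using out[of 2] card_arcs_between_distinct(2)[OF G, of 1 2]
      card_arcs_between_distinct(1)[OF G, of 2 3] card_arcs_between_same[OF G, of 2]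
    by simp
  show "3 * vertex_count G 3 = edge_count G 1 3 + edge_count G 2 3 + 2 * edge_count G 3 3"
    using out[of 3] card_arcs_between_distinct(2)[OF G, of 1 3]
      card_arcs_between_distinct(2)[OF G, of 2 3] card_arcs_between_same[OF G, of 3]
    by simp
  have "2 * graph_size G = card (parcs G)"
    unfolding graph_size_def uedges_def
    using card_symmetric_arcs[OF arcs(2,4,5)] by simp
  also have "parcs G = Sigma (?V 1) ?N \<union> Sigma (?V 2) ?N \<union> Sigma (?V 3) ?N"
    using arcs(3) deg by fastforce
  also have "card \<dots> = card (Sigma (?V 1) ?N) + card (Sigma (?V 2) ?N) + card (Sigma (?V 3) ?N)"
    using finV finN by (subst card_Un_disjoint; (subst card_Un_disjoint)?) auto
  finally show "2 * graph_size G = vertex_count G 1 + 2 * vertex_count G 2 + 3 * vertex_count G 3"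
    using sum_deg[of 1] sum_deg[of 2] sum_deg[of 3] by simp
qed

section \<open>Labelled graphs in which every vertex has an earlier neighbour\<close>

text \<open>
  The witnesses must live on the vertex type of a given graph, so they are described by their edges
  \<open>(i, j)\<close> with \<open>i < j\<close> on \<open>{..<n}\<close> and carried over by an injective labelling \<open>\<phi>\<close>.
\<close>

definition labelled_graph :: "(nat \<Rightarrow> 'a) \<Rightarrow> nat \<Rightarrow> (nat \<times> nat) set \<Rightarrow> 'a pair_pre_digraph" where
  "labelled_graph \<phi> n E = \<lparr>pverts = \<phi> ` {..<n}, parcs = map_prod \<phi> \<phi> ` (E \<union> E\<inverse>)\<rparr>"

definition neighbours :: "(nat \<times> nat) set \<Rightarrow> nat \<Rightarrow> nat set" where
  "neighbours E i = {j. (i, j) \<in> E \<or> (j, i) \<in> E}"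

text \<open>
  Orienting every edge upwards makes the edge count the cardinality of \<open>E\<close>. The assumption \<open>parent\<close>
  yields connectedness: descending along earlier neighbours ends at vertex \<open>0\<close>.
\<close>

locale increasing_graph =
  fixes \<phi> :: "nat \<Rightarrow> 'a" and n :: nat and E :: "(nat \<times> nat) set"
  assumes inj: "inj_on \<phi> {..<n}"
    and increasing: "\<And>i j. (i, j) \<in> E \<Longrightarrow> i < j \<and> j < n"
    and parent: "\<And>j. 0 < j \<Longrightarrow> j < n \<Longrightarrow> \<exists>i. (i, j) \<in> E"
    and nonempty: "n > 0"
begin

abbreviation H :: "'a pair_pre_digraph" where "H \<equiv> labelled_graph \<phi> n E"

lemma subset_square: "E \<union> E\<inverse> \<subseteq> {..<n} \<times> {..<n}"
  by (auto dest: increasing)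

lemma order_eq: "graph_order H = n"
  using inj by (simp add: graph_order_def labelled_graph_def card_image)

lemma arc_iff: "(u, v) \<in> parcs H \<longleftrightarrow> (\<exists>i j. ((i, j) \<in> E \<or> (j, i) \<in> E) \<and> u = \<phi> i \<and> v = \<phi> j)"
  by (force simp: labelled_graph_def)

lemma is_pair_graph: "pair_graph H"
proof -
  have "finite E" using subset_square by (auto intro: finite_subset)
  moreover have "\<phi> i \<noteq> \<phi> j" if "(i, j) \<in> E" for i j
    using increasing[OF that] inj_onD[OF inj, of i j] by auto
  ultimately show ?thesis
    by unfold_locales
      (auto simp: labelled_graph_def symmetric_def intro!: symI dest: increasing, force+)
qed

lemma size_eq: "graph_size H = card E"
proof -
  let ?f = "\<lambda>(i, j). {\<phi> i, \<phi> j}"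
  have "inj_on ?f E"
  proof (rule inj_onI, clarify)
    fix i j k l assume ij: "(i, j) \<in> E" and kl: "(k, l) \<in> E" and eq: "{\<phi> i, \<phi> j} = {\<phi> k, \<phi> l}"
    from ij kl have "i < j" "j < n" "k < l" "l < n" by (auto dest: increasing)
    moreover from this eq have "\<phi> ` {i, j} = \<phi> ` {k, l}" by simp
    ultimately have "{i, j} = {k, l}"
      by (subst (asm) inj_on_image_eq_iff[OF inj]) auto
    with \<open>i < j\<close> \<open>k < l\<close> show "i = k \<and> j = l" by (auto simp: doubleton_eq_iff)
  qed
  moreover have "uedges H = ?f ` E"
    unfolding uedges_def labelled_graph_def by (force simp: insert_commute)
  ultimately show ?thesis by (simp add: graph_size_def card_image)
qed

lemma degree_eq:
  assumes "i < n"
  shows "degree H (\<phi> i) = card (neighbours E i)"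
proof -
  have sub: "neighbours E i \<subseteq> {..<n}"
    using subset_square by (auto simp: neighbours_def)
  have "k = i" if "\<phi> i = \<phi> k" "k < n" for k
    using that inj_onD[OF inj, of i k] assms by simp
  then have "{w. (\<phi> i, w) \<in> parcs H} = \<phi> ` neighbours E i"
    using increasing unfolding arc_iff neighbours_def by (blast dest: less_trans)
  then show ?thesis
    using inj_on_subset[OF inj sub] by (simp add: degree_eq_card card_image)
qed

lemma vertex_count_eq: "vertex_count H d = card {i. i < n \<and> card (neighbours E i) = d}"
proof -
  have "{v \<in> pverts H. degree H v = d} = \<phi> ` {i. i < n \<and> card (neighbours E i) = d}"
    using degree_eq by (auto simp: labelled_graph_def)
  moreover have "inj_on \<phi> {i. i < n \<and> card (neighbours E i) = d}"
    using inj by (rule inj_on_subset) auto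
  ultimately show ?thesis by (simp add: vertex_count_def card_image)
qed

lemma is_connected: "connected (with_proj H)"
proof -
  have step: "(\<phi> i, \<phi> j) \<in> parcs H" "(\<phi> j, \<phi> i) \<in> parcs H" if "(i, j) \<in> E" for i j
    using that by (auto simp: arc_iff)
  have root: "(\<phi> 0, \<phi> j) \<in> (parcs H)\<^sup>* \<and> (\<phi> j, \<phi> 0) \<in> (parcs H)\<^sup>*" if "j < n" for j
    using that
  proof (induction j rule: less_induct)
    case (less j)
    show ?case
    proof (cases "j = 0")
      case False
      with parent less.prems obtain i where "(i, j) \<in> E" by blast
      moreover from this less increasing
      have "(\<phi> 0, \<phi> i) \<in> (parcs H)\<^sup>* \<and> (\<phi> i, \<phi> 0) \<in> (parcs H)\<^sup>*" by force
      ultimately show ?thesis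
        using step by (meson rtrancl.rtrancl_into_rtrancl converse_rtrancl_into_rtrancl)
    qed simp
  qed
  have "pverts H = \<phi> ` {..<n}" by (simp add: labelled_graph_def)
  moreover have "(\<phi> i, \<phi> j) \<in> (parcs H)\<^sup>*" if "i < n" "j < n" for i j
    using root[OF that(1)] root[OF that(2)] by (blast intro: rtrancl_trans)
  ultimately show ?thesis
    unfolding pair_graph_connected_iff[OF is_pair_graph] using nonempty by auto
qed

lemma chemical_graphI:
  assumes "n \<ge> 7" "real (card E) \<le> (3 * real n - 3) / 2"
    and "\<And>i. i < n \<Longrightarrow> card (neighbours E i) \<le> 3"
  shows "chemical_graph H"
proof -
  have "degree H v \<le> 3" if "v \<in> pverts H" for v
    using that assms(3) degree_eq by (auto simp: labelled_graph_def)
  then show ?thesis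
    unfolding chemical_graph_def using is_pair_graph is_connected assms by (simp add: order_eq size_eq)
qed

end

section \<open>Witnesses with few leaves and with few vertices of degree two\<close>

lemma card_insert3_le: "card {a, b, c} \<le> 3"
  by (simp add: card_insert_if)

lemma card_insert2_le: "card {a, b} \<le> 2"
  by (simp add: card_insert_if)

text \<open>
  The path \<open>0, 1, ..., n - 1\<close> with the nested chords \<open>{0, n - 1}, {1, n - 2}, ...\<close>. The outermost
  chord closes the path to a Hamiltonian cycle.
\<close>

definition nested_chords :: "nat \<Rightarrow> nat \<Rightarrow> (nat \<times> nat) set" where
  "nested_chords n k = (\<lambda>i. (i, i + 1)) ` {..<n - 1} \<union> (\<lambda>i. (i, n - 1 - i)) ` {..<k}"

text \<open>
  Take \<open>k = m - (n - 1)\<close> nested chords on a Hamiltonian path. They form a matching, so no degree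
  exceeds \<open>3\<close>. If \<open>k > 0\<close> there is a Hamiltonian cycle and hence no leaf; if \<open>k = 0\<close> the graph is a
  path. The innermost chord stays off the path exactly because \<open>m \<le> (3 * n - 3) / 2\<close>.
\<close>

lemma exists_few_leaves:
  fixes G :: "'a pair_pre_digraph"
  assumes "chemical_graph G"
  shows "\<exists>H :: 'a pair_pre_digraph. chemical_graph H \<and>
    graph_order H = graph_order G \<and> graph_size H = graph_size G \<and>
    (vertex_count H 1 = 0 \<or> graph_size G + 1 = graph_order G \<and> vertex_count H 3 = 0)"
proof -
  define n where "n = graph_order G"
  define k where "k = graph_size G + 1 - n"
  have G: "pair_graph G" "connected (with_proj G)" and n: "n \<ge> 7"
    and "real (graph_size G) \<le> (3 * real n - 3) / 2"
    using assms by (auto simp: chemical_graph_def n_def)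
  then have k: "2 * k \<le> n - 1" and m: "graph_size G = n - 1 + k"
    using connected_size_ge[OF G] by (auto simp: n_def k_def)
  obtain \<phi> :: "nat \<Rightarrow> 'a" where \<phi>: "bij_betw \<phi> {0..<n} (pverts G)"
    using ex_bij_betw_nat_finite pair_graph_arcs(1)[OF G(1)] by (auto simp: n_def graph_order_def)
  define E where "E = nested_chords n k"
  have E_iff: "(i, j) \<in> E \<longleftrightarrow> (j = i + 1 \<and> j < n) \<or> (i < k \<and> j = n - 1 - i)" for i j
    unfolding E_def nested_chords_def by auto
  interpret increasing_graph \<phi> n E
  proof
    show "inj_on \<phi> {..<n}" using \<phi> by (simp add: bij_betw_def lessThan_atLeast0)
    show "i < j \<and> j < n" if "(i, j) \<in> E" for i j
      using that k n unfolding E_iff by auto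
    show "\<exists>i. (i, j) \<in> E" if "0 < j" "j < n" for j
      using that unfolding E_iff by (intro exI[of _ "j - 1"]) auto
  qed (use n in simp)
  have cardE: "card E = n - 1 + k"
  proof -
    have "card E = card ((\<lambda>i. (i, i + 1)) ` {..<n - 1}) + card ((\<lambda>i. (i, n - 1 - i)) ` {..<k})"
      unfolding E_def nested_chords_def using k n by (subst card_Un_disjoint) auto
    then show ?thesis by (simp add: card_image inj_on_def)
  qed
  have N: "neighbours E i = {j. j = i + 1 \<and> j < n \<or> i = j + 1 \<and> i < n \<or>
      i < k \<and> j = n - 1 - i \<or> j < k \<and> i = n - 1 - j}" for i
    by (auto simp: neighbours_def E_iff)
  have le3: "card (neighbours E i) \<le> 3" if "i < n" for i
  proof -
    have "neighbours E i \<subseteq> {i - 1, i + 1, n - 1 - i}" using that k by (auto simp: N)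
    then have "card (neighbours E i) \<le> card {i - 1, i + 1, n - 1 - i}" by (intro card_mono) auto
    also have "\<dots> \<le> 3" by (rule card_insert3_le)
    finally show ?thesis .
  qed
  have fin: "finite (neighbours E i)" for i
    by (rule finite_subset[of _ "{..<n}"]) (use subset_square in \<open>auto simp: neighbours_def\<close>)
  have "chemical_graph H"
    using n k le3 by (intro chemical_graphI) (auto simp: cardE)
  moreover have "vertex_count H 1 = 0" if "k > 0"
  proof -
    have "card (neighbours E i) \<noteq> 1" if i: "i < n" for i
    proof -
      \<comment> \<open>\<open>a\<close> and \<open>b\<close> are the two neighbours of \<open>i\<close> on the Hamiltonian cycle.\<close>
      define a where "a = (if i = 0 then n - 1 else i - 1)"
      define b where "b = (if i = n - 1 then 0 else i + 1)"
      have "{a, b} \<subseteq> neighbours E i"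
        using \<open>k > 0\<close> i n by (auto simp: N a_def b_def)
      then have "card {a, b} \<le> card (neighbours E i)" using fin by (rule card_mono[rotated])
      moreover have "a \<noteq> b" using i n by (auto simp: a_def b_def split: if_splits)
      ultimately show ?thesis by simp
    qed
    then have "{i. i < n \<and> card (neighbours E i) = 1} = {}" by auto
    then show ?thesis unfolding vertex_count_eq by (simp only: card.empty)
  qed
  moreover have "vertex_count H 3 = 0" if "k = 0"
  proof -
    have "card (neighbours E i) \<noteq> 3" for i
    proof -
      have "neighbours E i \<subseteq> {i - 1, i + 1}" using \<open>k = 0\<close> by (auto simp: N)
      then have "card (neighbours E i) \<le> card {i - 1, i + 1}" by (intro card_mono) auto
      also have "\<dots> \<le> 2" by (rule card_insert2_le)
      finally show ?thesis by simp
    qed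
    then show ?thesis by (simp add: vertex_count_eq)
  qed
  moreover have "graph_order H = graph_order G" "graph_size H = graph_size G"
    using m order_eq size_eq cardE by (simp_all add: n_def[symmetric])
  moreover have "k > 0 \<or> k = 0 \<and> graph_size G + 1 = graph_order G"
    using m n unfolding n_def by auto
  ultimately show ?thesis by blast
qed

text \<open>
  A spine \<open>0, 1, ..., s + k\<close> in which every vertex except \<open>0\<close> receives one further edge. The rule
  \<open>i \<rightarrow> i + s\<close> for \<open>1 \<le> i \<le> s\<close> yields at once the \<open>k\<close> chords (when \<open>i + s\<close> lies on the spine) and the
  \<open>s - k\<close> pendant leaves (when it does not). This gives \<open>n = 2 * s + 1\<close> vertices; for even \<open>n\<close> one more
  leaf is hung on the end of the spine.
\<close>

definition caterpillar_chords :: "nat \<Rightarrow> nat \<Rightarrow> nat \<Rightarrow> (nat \<times> nat) set" where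
  "caterpillar_chords n s k =
     (\<lambda>i. (i, i + 1)) ` {..<s + k} \<union> (\<lambda>i. (i, i + s)) ` {1..s} \<union>
     (if even n then {(s + k, n - 1)} else {})"

text \<open>
  Take \<open>k = m - (n - 1)\<close> in the family above. Inner vertices of the spine have degree \<open>3\<close>, vertex \<open>0\<close>
  and the vertices off the spine are leaves, so only the end \<open>s + k\<close> of the spine can have degree \<open>2\<close>.
  The bound on \<open>m\<close> becomes \<open>k \<le> s\<close>, which leaves room for all chords, and \<open>n \<ge> 7\<close> gives \<open>s \<ge> 3\<close>, which
  keeps chords and spine edges apart.
\<close>

lemma exists_few_degree_2:
  fixes G :: "'a pair_pre_digraph"
  assumes "chemical_graph G"
  shows "\<exists>H :: 'a pair_pre_digraph. chemical_graph H \<and>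
    graph_order H = graph_order G \<and> graph_size H = graph_size G \<and> vertex_count H 2 \<le> 1"
proof -
  define n where "n = graph_order G"
  define k where "k = graph_size G + 1 - n"
  define s where "s = (n - 1) div 2"
  have G: "pair_graph G" "connected (with_proj G)" and n7: "n \<ge> 7"
    and "real (graph_size G) \<le> (3 * real n - 3) / 2"
    using assms by (auto simp: chemical_graph_def n_def)
  then have "2 * k \<le> n - 1" and m: "graph_size G = n - 1 + k"
    using connected_size_ge[OF G] by (auto simp: n_def k_def)
  then have k: "k \<le> s" and s: "s \<ge> 3"
    using n7 by (auto simp: s_def)
  have n: "even n \<and> n = 2 * s + 2 \<or> odd n \<and> n = 2 * s + 1"
    using n7 unfolding s_def by presburger
  obtain \<phi> :: "nat \<Rightarrow> 'a" where \<phi>: "bij_betw \<phi> {0..<n} (pverts G)"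
    using ex_bij_betw_nat_finite pair_graph_arcs(1)[OF G(1)] by (auto simp: n_def graph_order_def)
  define E where "E = caterpillar_chords n s k"
  have E_iff: "(i, j) \<in> E \<longleftrightarrow> (i < s + k \<and> j = i + 1) \<or> (1 \<le> i \<and> i \<le> s \<and> j = i + s) \<or>
      (even n \<and> i = s + k \<and> j = 2 * s + 1)" for i j
    unfolding E_def caterpillar_chords_def using n by (auto split: if_splits)
  interpret increasing_graph \<phi> n E
  proof
    show "inj_on \<phi> {..<n}" using \<phi> by (simp add: bij_betw_def lessThan_atLeast0)
    show "i < j \<and> j < n" if "(i, j) \<in> E" for i j
      using that k s n unfolding E_iff by (auto split: if_splits)
    show "\<exists>i. (i, j) \<in> E" if "0 < j" "j < n" for j
    proof -
      have "j \<le> 2 * s \<or> even n \<and> j = 2 * s + 1" using that n by auto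
      then consider "j \<le> s + k" | "s + k < j" "j \<le> 2 * s" | "even n" "j = 2 * s + 1"
        by linarith
      then show ?thesis
      proof cases
        case 1 then show ?thesis using that unfolding E_iff by (intro exI[of _ "j - 1"]) auto
      next
        case 2 then show ?thesis unfolding E_iff by (intro exI[of _ "j - s"]) auto
      next
        case 3 then show ?thesis unfolding E_iff by blast
      qed
    qed
  qed (use n7 in simp)
  have cardE: "card E = n - 1 + k"
  proof -
    let ?A = "(\<lambda>i. (i, i + 1)) ` {..<s + k}" and ?B = "(\<lambda>i. (i, i + s)) ` {1..s}"
    have AB: "card (?A \<union> ?B) = 2 * s + k"
      using s by (subst card_Un_disjoint) (auto simp: card_image inj_on_def)
    show ?thesis
    proof (cases "even n")
      case True
      moreover have "(s + k, n - 1) \<notin> ?A \<union> ?B" using True n by auto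
      ultimately show ?thesis using AB n by (simp add: E_def caterpillar_chords_def)
    next
      case False
      then show ?thesis using AB n by (simp add: E_def caterpillar_chords_def)
    qed
  qed
  \<comment> \<open>The candidates for the further neighbour and for the upper neighbour of a spine vertex. For odd \<open>n\<close>,
    \<open>succ (s + k)\<close> is not a vertex; the value then only serves to bound the degree by \<open>3\<close>.\<close>
  define partner where "partner i = (if i \<le> s then i + s else i - s)" for i
  define succ where "succ i = (if i < s + k then i + 1 else 2 * s + 1)" for i
  have N: "neighbours E i = {j. i < s + k \<and> j = i + 1 \<or> j < s + k \<and> i = j + 1 \<or>
      1 \<le> i \<and> i \<le> s \<and> j = i + s \<or> 1 \<le> j \<and> j \<le> s \<and> i = j + s \<or>
      even n \<and> i = s + k \<and> j = 2 * s + 1 \<or> even n \<and> j = s + k \<and> i = 2 * s + 1}" for i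
    by (auto simp: neighbours_def E_iff)
  have spine: "neighbours E i = {i - 1, partner i, succ i}" if "1 \<le> i" "i < s + k" for i
    using that k s by (auto simp: N partner_def succ_def)
  have spine_end: "neighbours E (s + k) = {s + k - 1, partner (s + k)} \<union>
      (if even n then {succ (s + k)} else {})"
    using k s by (auto simp: N partner_def succ_def)
  have spine_card: "card {i - 1, partner i, succ i} = 3" if "1 \<le> i" "i \<le> s + k" for i
  proof -
    have "i - 1 \<noteq> partner i" "i - 1 \<noteq> succ i" "partner i \<noteq> succ i"
      using that k s by (auto simp: partner_def succ_def)
    then show ?thesis by simp
  qed
  have first: "neighbours E 0 = {1}"
    using k s by (auto simp: N)
  have leaf: "neighbours E i = {if i \<le> 2 * s then i - s else s + k}" if "s + k < i" "i < n" for i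
    using that k s n by (auto simp: N split: if_splits)
  have cards: "card (neighbours E i) = 1 \<or> card (neighbours E i) = 3 \<or>
      i = s + k \<and> card (neighbours E i) \<le> 3" if "i < n" for i
  proof -
    consider "i = 0" | "1 \<le> i" "i < s + k" | "i = s + k" | "s + k < i" using s by linarith
    then show ?thesis
    proof cases
      case 1 then show ?thesis by (simp add: first)
    next
      case 2 then show ?thesis using spine[of i] spine_card[of i] by simp
    next
      case 3
      have "neighbours E i \<subseteq> {i - 1, partner i, succ i}" using 3 spine_end by auto
      then have "card (neighbours E i) \<le> card {i - 1, partner i, succ i}" by (intro card_mono) auto
      then show ?thesis using 3 spine_card[of i] s by simp
    next
      case 4 then show ?thesis using leaf[of i] that by simp
    qed
  qed
  have "card (neighbours E i) \<le> 3" if "i < n" for i using cards[OF that] by auto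
  then have "chemical_graph H"
    using n7 \<open>2 * k \<le> n - 1\<close> by (intro chemical_graphI) (auto simp: cardE)
  moreover have "vertex_count H 2 \<le> 1"
  proof -
    have "{i. i < n \<and> card (neighbours E i) = 2} \<subseteq> {s + k}" using cards by fastforce
    then have "vertex_count H 2 \<le> card {s + k}" unfolding vertex_count_eq by (intro card_mono) auto
    then show ?thesis by simp
  qed
  moreover have "graph_order H = graph_order G" "graph_size H = graph_size G"
    using m order_eq size_eq cardE by (simp_all add: n_def[symmetric])
  ultimately show ?thesis by blast
qed

section \<open>Reduction to the number of leaves\<close>

definition competitor :: "'a pair_pre_digraph \<Rightarrow> 'a pair_pre_digraph \<Rightarrow> bool" where
  "competitor G H \<longleftrightarrow> chemical_graph H \<and> graph_order H = graph_order G \<and> graph_size H = graph_size G"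

text \<open>
  Once order and size are fixed, one free parameter remains: the number of leaves determines the
  number of vertices of degree \<open>2\<close>, with slope \<open>-2\<close>, and of degree \<open>3\<close>, with slope \<open>1\<close>.
\<close>

lemma chemical_graph_leaf_equations:
  assumes "chemical_graph G"
  shows "3 * graph_order G = 2 * graph_size G + vertex_count G 2 + 2 * vertex_count G 1"
    and "vertex_count G 3 + 2 * graph_order G = vertex_count G 1 + 2 * graph_size G"
  using chemical_graph_counts[OF assms] by linarith+

text \<open>
  When the coefficients split as \<open>g i + g j\<close>, every vertex \<open>v\<close> contributes \<open>g (deg v)\<close> once for each
  incident edge.
\<close>

lemma topological_index_eq_vertex_sum:
  assumes "chemical_graph G" and "\<And>i j. c i j = g i + g j"
  shows "topological_index c G =
    g 1 * real (vertex_count G 1) + 2 * g 2 * real (vertex_count G 2) +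
    3 * g 3 * real (vertex_count G 3)"
proof -
  have v2: "2 * real (vertex_count G 2) =
      real (edge_count G 1 2) + 2 * real (edge_count G 2 2) + real (edge_count G 2 3)"
    and v3: "3 * real (vertex_count G 3) =
      real (edge_count G 1 3) + real (edge_count G 2 3) + 2 * real (edge_count G 3 3)"
    using chemical_graph_counts(3,4)[OF assms(1)] by linarith+
  have "g 1 * real (vertex_count G 1) + 2 * g 2 * real (vertex_count G 2) +
      3 * g 3 * real (vertex_count G 3) =
    g 1 * real (vertex_count G 1) + g 2 * (2 * real (vertex_count G 2)) +
      g 3 * (3 * real (vertex_count G 3))"
    by simp
  then show ?thesis
    unfolding v2 v3 topological_index_def assms(2) chemical_graph_counts(2)[OF assms(1)]
    by (simp add: algebra_simps del: One_nat_def)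
qed

lemma topological_index_diff:
  assumes "chemical_graph G" "competitor G H" and "\<And>i j. c i j = g i + g j"
  shows "topological_index c H - topological_index c G =
    (g 1 - 4 * g 2 + 3 * g 3) * (real (vertex_count H 1) - real (vertex_count G 1))"
proof -
  have H: "chemical_graph H" and eq: "graph_order H = graph_order G" "graph_size H = graph_size G"
    using assms(2) by (auto simp: competitor_def)
  define \<delta> where "\<delta> = real (vertex_count H 1) - real (vertex_count G 1)"
  have 1: "real (vertex_count H 1) = real (vertex_count G 1) + \<delta>" by (simp add: \<delta>_def)
  have 2: "real (vertex_count H 2) = real (vertex_count G 2) - 2 * \<delta>"
    using chemical_graph_leaf_equations(1)[OF assms(1)] chemical_graph_leaf_equations(1)[OF H] 1
    unfolding eq by linarith
  have 3: "real (vertex_count H 3) = real (vertex_count G 3) + \<delta>"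
    using chemical_graph_leaf_equations(2)[OF assms(1)] chemical_graph_leaf_equations(2)[OF H] 1
    unfolding eq by linarith
  show ?thesis
    unfolding topological_index_eq_vertex_sum[OF assms(1,3)] topological_index_eq_vertex_sum[OF H assms(3)]
      \<delta>_def[symmetric] 1 2 3
    by (simp add: algebra_simps)
qed

text \<open>
  The condition on \<open>g\<close> says that the second difference of \<open>d * g d\<close> at \<open>d = 2\<close> is not zero. That second
  difference is the slope of the index in the number of leaves, and its sign only decides whether
  maximizing the index means maximizing or minimizing the leaves.
\<close>

lemma extremal_iff_leaf_count:
  assumes "\<And>i j. c i j = g i + g j" and "g 1 - 4 * g 2 + 3 * g 3 \<noteq> 0"
  shows "extremal (topological_index c) G \<longleftrightarrow> chemical_graph G \<and>
    ((\<forall>H. competitor G H \<longrightarrow> vertex_count H 1 \<le> vertex_count G 1) \<or>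
     (\<forall>H. competitor G H \<longrightarrow> vertex_count G 1 \<le> vertex_count H 1))"
proof (cases "chemical_graph G")
  case True
  let ?f = "topological_index c" and ?D = "g 1 - 4 * g 2 + 3 * g 3"
  have diff: "?f H - ?f G = ?D * (real (vertex_count H 1) - real (vertex_count G 1))"
    if "competitor G H" for H
    using topological_index_diff[OF True that assms(1)] .
  consider "?D > 0" | "?D < 0" using assms(2) by linarith
  then show ?thesis
  proof cases
    case 1
    then have "?f H \<le> ?f G \<longleftrightarrow> vertex_count H 1 \<le> vertex_count G 1"
      "?f G \<le> ?f H \<longleftrightarrow> vertex_count G 1 \<le> vertex_count H 1" if "competitor G H" for H
      using diff[OF that] mult_le_0_iff[of ?D] zero_le_mult_iff[of ?D]
      by (smt (verit) of_nat_le_iff)+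
    then show ?thesis using True unfolding extremal_def competitor_def by blast
  next
    case 2
    then have "?f H \<le> ?f G \<longleftrightarrow> vertex_count G 1 \<le> vertex_count H 1"
      "?f G \<le> ?f H \<longleftrightarrow> vertex_count H 1 \<le> vertex_count G 1" if "competitor G H" for H
      using diff[OF that] mult_le_0_iff[of ?D] zero_le_mult_iff[of ?D]
      by (smt (verit) of_nat_le_iff)+
    then show ?thesis using True unfolding extremal_def competitor_def by blast
  qed
qed (simp add: extremal_def)

text \<open>
  By parity a graph with at most one vertex of degree \<open>2\<close> has as few of them as its order permits, so
  it has the most leaves. The other direction compares with such a graph.
\<close>

lemma max_leaves_iff:
  assumes "chemical_graph G"
  shows "(\<forall>H. competitor G H \<longrightarrow> vertex_count H 1 \<le> vertex_count G 1) \<longleftrightarrow> vertex_count G 2 \<le> 1"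
proof
  assume max: "\<forall>H. competitor G H \<longrightarrow> vertex_count H 1 \<le> vertex_count G 1"
  obtain H :: "'a pair_pre_digraph" where H: "competitor G H" "vertex_count H 2 \<le> 1"
    using exists_few_degree_2[OF assms] by (auto simp: competitor_def)
  then show "vertex_count G 2 \<le> 1"
    using max chemical_graph_leaf_equations(1)[OF assms] chemical_graph_leaf_equations(1)[of H]
    by (fastforce simp: competitor_def)
next
  assume "vertex_count G 2 \<le> 1"
  show "\<forall>H. competitor G H \<longrightarrow> vertex_count H 1 \<le> vertex_count G 1"
  proof (intro allI impI)
    fix H :: "'a pair_pre_digraph" assume "competitor G H"
    then show "vertex_count H 1 \<le> vertex_count G 1"
      using chemical_graph_leaf_equations(1)[OF assms] chemical_graph_leaf_equations(1)[of H]
        \<open>vertex_count G 2 \<le> 1\<close>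
      unfolding competitor_def by linarith
  qed
qed

text \<open>
  For trees the number of leaves exceeds the number of vertices of degree \<open>3\<close> by two, so it is least
  when the latter is \<open>0\<close>; as soon as there is a cycle, leaves can be avoided altogether.
\<close>

lemma min_leaves_iff:
  assumes "chemical_graph G"
  shows "(\<forall>H. competitor G H \<longrightarrow> vertex_count G 1 \<le> vertex_count H 1) \<longleftrightarrow>
    vertex_count G 1 = 0 \<or> graph_size G + 1 = graph_order G \<and> vertex_count G 3 = 0"
proof
  assume min: "\<forall>H. competitor G H \<longrightarrow> vertex_count G 1 \<le> vertex_count H 1"
  obtain H :: "'a pair_pre_digraph" where H: "competitor G H" and
    few: "vertex_count H 1 = 0 \<or> graph_size G + 1 = graph_order G \<and> vertex_count H 3 = 0"
    using exists_few_leaves[OF assms] by (auto simp: competitor_def)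
  from min H have "vertex_count G 1 \<le> vertex_count H 1" by blast
  then show "vertex_count G 1 = 0 \<or> graph_size G + 1 = graph_order G \<and> vertex_count G 3 = 0"
    using few chemical_graph_leaf_equations(2)[OF assms] chemical_graph_leaf_equations(2)[of H] H
    unfolding competitor_def by linarith
next
  assume few: "vertex_count G 1 = 0 \<or> graph_size G + 1 = graph_order G \<and> vertex_count G 3 = 0"
  show "\<forall>H. competitor G H \<longrightarrow> vertex_count G 1 \<le> vertex_count H 1"
  proof (intro allI impI)
    fix H :: "'a pair_pre_digraph" assume "competitor G H"
    then show "vertex_count G 1 \<le> vertex_count H 1"
      using chemical_graph_leaf_equations(2)[OF assms] chemical_graph_leaf_equations(2)[of H] few
      unfolding competitor_def by linarith
  qed
qed

section \<open>Reading off the edge vectors\<close>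

text \<open>
  If the only vertex of degree \<open>2\<close> were adjacent to two leaves, these three vertices would be a whole
  component, which is too small.
\<close>

lemma edge_count_12_le_1:
  assumes "chemical_graph G" "vertex_count G 2 = 1"
  shows "edge_count G 1 2 \<le> 1"
proof (rule ccontr)
  assume "\<not> edge_count G 1 2 \<le> 1"
  have G: "pair_graph G" "connected (with_proj G)" and ge: "graph_order G \<ge> 7"
    using assms by (auto simp: chemical_graph_def)
  note arcs = pair_graph_arcs[OF G(1)]
  obtain u where u: "{v \<in> pverts G. degree G v = 2} = {u}"
    using assms(2) by (auto simp: vertex_count_def card_1_singleton_iff)
  let ?N = "{w. (u, w) \<in> parcs G}"
  have fin: "finite ?N" using arcs by (auto intro!: finite_subset[of _ "pverts G"])
  have two: "card ?N = 2" using u by (auto simp: degree_eq_card[symmetric])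
  have "arcs_between G 2 1 \<subseteq> Pair u ` ?N"
    using u arcs(3) by (auto simp: arcs_between_def)
  moreover have "card (Pair u ` ?N) \<le> card (arcs_between G 2 1)"
    using \<open>\<not> edge_count G 1 2 \<le> 1\<close> card_arcs_between_distinct(2)[OF G(1), of 1 2] two
    by (simp add: card_image inj_on_def)
  ultimately have eq: "arcs_between G 2 1 = Pair u ` ?N"
    using fin by (intro card_seteq) auto
  have return: "z = u" if "w \<in> ?N" "(w, z) \<in> parcs G" for w z
  proof -
    from that eq have "card {z. (w, z) \<in> parcs G} = 1"
      by (auto simp: arcs_between_def degree_eq_card)
    moreover have "(w, u) \<in> parcs G" using that arcs(4) by (auto dest: symD)
    ultimately show ?thesis using that(2) by (auto simp: card_1_singleton_iff set_eq_iff)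
  qed
  have "pverts G \<subseteq> insert u ?N"
  proof (rule connected_closed_subset[OF G])
    show "u \<in> pverts G" using u by auto
  qed (use return in auto)
  then have "graph_order G \<le> card (insert u ?N)"
    unfolding graph_order_def using fin by (intro card_mono) auto
  also have "\<dots> \<le> 3" using fin two by (simp add: card_insert_if)
  finally show False using ge by simp
qed

text \<open>
  Without an edge between degrees \<open>2\<close> and \<open>3\<close>, and without leaves, the vertices of degree \<open>2\<close> would be
  closed under adjacency.
\<close>

lemma edge_count_23_pos:
  assumes "chemical_graph G" "vertex_count G 1 = 0" "vertex_count G 2 > 0" "vertex_count G 3 > 0"
  shows "edge_count G 2 3 > 0"
proof (rule ccontr)
  assume "\<not> edge_count G 2 3 > 0"
  have G: "pair_graph G" "connected (with_proj G)" using assms(1) by (auto simp: chemical_graph_def)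
  note arcs = pair_graph_arcs[OF G(1)]
  let ?S = "{v \<in> pverts G. degree G v = 2}"
  have "finite (arcs_between G 2 3)"
    using arcs(2) by (rule finite_subset[rotated]) (auto simp: arcs_between_def)
  then have no23: "arcs_between G 2 3 = {}"
    using \<open>\<not> edge_count G 2 3 > 0\<close> card_arcs_between_distinct(1)[OF G(1), of 2 3] by simp
  have no1: "degree G v \<noteq> 1" if "v \<in> pverts G" for v
    using assms(2) that arcs(1) by (auto simp: vertex_count_def)
  obtain u where u: "u \<in> ?S" using assms(3) by (auto simp: vertex_count_def card_gt_0_iff)
  have "pverts G \<subseteq> ?S"
  proof (rule connected_closed_subset[OF G])
    fix v w assume "v \<in> ?S" "(v, w) \<in> parcs G"
    then show "w \<in> ?S"
      using no23 no1[of w] chemical_graph_degree[OF assms(1), of w] arcs(3)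
      by (auto simp: arcs_between_def)
  qed (use u in auto)
  then have "{v \<in> pverts G. degree G v = 3} = {}" by auto
  then have "vertex_count G 3 = 0" unfolding vertex_count_def by (simp only: card.empty)
  then show False using assms(4) by simp
qed

text \<open>
  With a single vertex of degree \<open>2\<close>, the only choice left is whether its neighbours have degrees
  \<open>3, 3\<close> or \<open>1, 3\<close>; these are the two families.
\<close>

lemma F1_F3_iff:
  assumes "chemical_graph G"
  shows "G \<in> F1 \<union> F3 \<longleftrightarrow> vertex_count G 2 \<le> 1"
proof
  note v2 = chemical_graph_counts(3)[OF assms]
  assume "G \<in> F1 \<union> F3"
  then have "real (edge_count G 1 2) + 2 * real (edge_count G 2 2) + real (edge_count G 2 3) \<le> 2"
    unfolding F1_def F3_def edge_vector_def Let_def by (auto split: if_splits)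
  then show "vertex_count G 2 \<le> 1" using v2 by linarith
next
  assume le1: "vertex_count G 2 \<le> 1"
  have G: "pair_graph G" using assms by (simp add: chemical_graph_def)
  note counts = chemical_graph_counts[OF assms]
  note leaf = chemical_graph_leaf_equations[OF assms]
  show "G \<in> F1 \<union> F3"
  proof (cases "vertex_count G 2 = 0")
    case True
    then have "even (graph_order G)" using leaf(1) by presburger
    moreover have "edge_count G 1 2 = 0" "edge_count G 2 2 = 0" "edge_count G 2 3 = 0"
      using True counts(3) by auto
    moreover have "2 * real (edge_count G 1 3) = 3 * real (graph_order G) - 2 * real (graph_size G)"
      and "2 * real (edge_count G 3 3) = 4 * real (graph_size G) - 3 * real (graph_order G)"
      using counts leaf True by linarith+
    ultimately show ?thesis using assms by (simp add: F1_def edge_vector_def)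
  next
    case False
    then have one: "vertex_count G 2 = 1" using le1 by simp
    then have odd: "odd (graph_order G)" using leaf(1) by presburger
    have x22: "edge_count G 2 2 = 0" using edge_count_same_le[OF G, of 2] one by simp
    consider "edge_count G 1 2 = 0" "edge_count G 2 3 = 2"
      | "edge_count G 1 2 = 1" "edge_count G 2 3 = 1"
      using edge_count_12_le_1[OF assms one] counts(3) one x22 by linarith
    then show ?thesis
    proof cases
      case 1
      then have "2 * real (edge_count G 1 3) = 3 * real (graph_order G) - 2 * real (graph_size G) - 1"
        and "2 * real (edge_count G 3 3) = 4 * real (graph_size G) - 3 * real (graph_order G) - 3"
        using counts leaf one by linarith+
      with 1 x22 odd show ?thesis using assms by (simp add: F1_def edge_vector_def)
    next
      case 2
      then have "2 * real (edge_count G 1 3) = 3 * real (graph_order G) - 2 * real (graph_size G) - 3"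
        and "2 * real (edge_count G 3 3) = 4 * real (graph_size G) - 3 * real (graph_order G) - 1"
        using counts leaf one by linarith+
      with 2 x22 odd show ?thesis using assms by (simp add: F3_def edge_vector_def)
    qed
  qed
qed

text \<open>
  Without leaves, the equations for degrees \<open>2\<close> and \<open>3\<close> leave \<open>a = x22\<close> as the only parameter. Its lower
  bounds say that \<open>x22\<close> and \<open>x33\<close> are nonnegative. Its upper bound is connectedness: the number of
  edges between degrees \<open>2\<close> and \<open>3\<close> is positive and even, hence at least \<open>2\<close>. For \<open>m = n + 1\<close> there are
  only two vertices of degree \<open>3\<close>, hence at most one edge between them.
\<close>

lemma F5_iff:
  assumes "chemical_graph G"
  shows "G \<in> F5 \<longleftrightarrow>
    vertex_count G 1 = 0 \<or> graph_size G + 1 = graph_order G \<and> vertex_count G 3 = 0"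
proof
  note counts = chemical_graph_counts[OF assms]
  assume "G \<in> F5"
  then consider "graph_size G + 1 = graph_order G" "edge_count G 1 3 = 0" "edge_count G 2 3 = 0"
      "edge_count G 3 3 = 0"
    | "edge_count G 1 2 = 0" "edge_count G 1 3 = 0"
    unfolding F5_def edge_vector_def Let_def by auto
  then show "vertex_count G 1 = 0 \<or> graph_size G + 1 = graph_order G \<and> vertex_count G 3 = 0"
    using counts(2,4) by cases auto
next
  assume few: "vertex_count G 1 = 0 \<or> graph_size G + 1 = graph_order G \<and> vertex_count G 3 = 0"
  have G: "pair_graph G" "connected (with_proj G)" and ge: "graph_order G \<ge> 7"
    and le: "real (graph_size G) \<le> (3 * real (graph_order G) - 3) / 2"
    using assms by (auto simp: chemical_graph_def)
  note counts = chemical_graph_counts[OF assms]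
  note leaf = chemical_graph_leaf_equations[OF assms]
  let ?n = "graph_order G" and ?m = "graph_size G"
  consider "?m + 1 = ?n" | "?m = ?n" | "?m = ?n + 1" | "?m > ?n + 1"
    using connected_size_ge[OF G] by linarith
  then show "G \<in> F5"
  proof cases
    case 1
    then have "vertex_count G 1 = 2" "vertex_count G 3 = 0" using few leaf(2) by linarith+
    then have "edge_count G 1 3 = 0" "edge_count G 2 3 = 0" "edge_count G 3 3 = 0"
      "edge_count G 1 2 = 2" "edge_count G 2 2 + 2 = ?m"
      using counts 1 by linarith+
    then show ?thesis using assms 1 by (simp add: F5_def edge_vector_def)
  next
    case 2
    then have "vertex_count G 1 = 0" "vertex_count G 3 = 0" using few leaf(2) by linarith+
    then have "edge_count G 1 3 = 0" "edge_count G 2 3 = 0" "edge_count G 3 3 = 0"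
      "edge_count G 1 2 = 0" "edge_count G 2 2 = ?m"
      using counts 2 by linarith+
    then show ?thesis using assms 2 by (simp add: F5_def edge_vector_def)
  next
    case 3
    then have "vertex_count G 1 = 0" "vertex_count G 3 = 2" using few leaf(2) by linarith+
    moreover from this have "edge_count G 3 3 \<le> 1" using edge_count_same_le[OF G(1), of 3] by simp
    then consider "edge_count G 3 3 = 0" | "edge_count G 3 3 = 1" by linarith
    then have "edge_count G 3 3 = 0 \<and> edge_count G 2 3 = 6 \<and> edge_count G 2 2 + 6 = ?m \<or>
      edge_count G 3 3 = 1 \<and> edge_count G 2 3 = 4 \<and> edge_count G 2 2 + 5 = ?m"
      using calculation counts 3 by cases auto
    moreover have "edge_count G 1 3 = 0" "edge_count G 1 2 = 0"
      using calculation counts by linarith+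
    ultimately show ?thesis using assms 3 by (auto simp: F5_def edge_vector_def)
  next
    case 4
    then have v1: "vertex_count G 1 = 0" using few by linarith
    have "real (2 * ?m) < real (3 * ?n)" using le by simp
    then have v2: "vertex_count G 2 > 0" using leaf(1) v1 by linarith
    have v3: "vertex_count G 3 > 0" using leaf(2) v1 4 by linarith
    have x: "edge_count G 1 2 = 0" "edge_count G 1 3 = 0" using v1 counts(2) by linarith+
    have "even (edge_count G 2 3)" using counts(3) x by presburger
    with edge_count_23_pos[OF assms v1 v2 v3] have "edge_count G 2 3 \<ge> 2" by presburger
    then have "edge_count G 2 2 + 2 * ?m + 1 \<le> 3 * ?n" using counts(3) x leaf(1) v1 by linarith
    moreover have "edge_count G 2 3 + 4 * ?m + 2 * edge_count G 2 2 = 6 * ?n"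
      "edge_count G 3 3 + 6 * ?n = 5 * ?m + edge_count G 2 2"
      using counts x leaf v1 by linarith+
    ultimately have
      "max 0 (6 * real ?n - 5 * real ?m) \<le> real_of_int (int (edge_count G 2 2))"
      "real_of_int (int (edge_count G 2 2)) \<le> 3 * real ?n - 2 * real ?m - 1"
      "edge_vector G = (0, 0, real_of_int (int (edge_count G 2 2)),
         6 * real ?n - 4 * real ?m - 2 * real_of_int (int (edge_count G 2 2)),
         5 * real ?m - 6 * real ?n + real_of_int (int (edge_count G 2 2)))"
      unfolding edge_vector_def prod.inject using x by auto
    moreover have "real ?n + 1 < real ?m" using 4 by linarith
    ultimately show ?thesis unfolding F5_def Let_def using assms le by blast
  qed
qed

section \<open>The six indices\<close>

text \<open>
  For the indices with logarithms the second difference is the logarithm of \<open>9 / 16\<close> or \<open>27 / 16\<close>, up to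
  sign and scale; for the others it is a nonzero rational number.
\<close>

lemma index_vertex_weights:
  assumes "c \<in> {forgotten, inv_deg, zagreb1, ln_zagreb2, ln_zagreb3, m_zagreb}"
  obtains g :: "nat \<Rightarrow> real"
  where "\<And>i j. c i j = g i + g j" "g 1 - 4 * g 2 + 3 * g 3 \<noteq> 0"
proof -
  have ln4: "4 * ln 2 = ln (16 :: real)" using ln_realpow[of 2 4] by simp
  have ln9: "2 * ln 3 = ln (9 :: real)" using ln_realpow[of 3 2] by simp
  have ln27: "3 * ln 3 = ln (27 :: real)" using ln_realpow[of 3 3] by simp
  from assms consider "c = forgotten" | "c = inv_deg" | "c = zagreb1" | "c = ln_zagreb2"
    | "c = ln_zagreb3" | "c = m_zagreb" by blast
  then show thesis
  proof cases
    case 1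
    then show thesis by (intro that[of "\<lambda>d. real d ^ 2"]) (simp_all add: forgotten_def)
  next
    case 2
    then show thesis by (intro that[of "\<lambda>d. 1 / real d ^ 2"]) (simp_all add: inv_deg_def)
  next
    case 3
    then show thesis by (intro that[of real]) (simp_all add: zagreb1_def)
  next
    case 4
    have "ln (9 :: real) \<noteq> ln 16" by simp
    with 4 ln4 ln9 show thesis
      by (intro that[of "\<lambda>d. 2 * (ln (real d) / real d)"]) (simp_all add: ln_zagreb2_def)
  next
    case 5
    have "ln (27 :: real) \<noteq> ln 16" by simp
    with 5 ln4 ln27 show thesis
      by (intro that[of "\<lambda>d. ln (real d)"]) (simp_all add: ln_zagreb3_def)
  next
    case 6
    then show thesis by (intro that[of "\<lambda>d. 1 / real d ^ 3"]) (simp_all add: m_zagreb_def)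
  qed
qed

theorem corollary13:
  fixes c :: "nat \<Rightarrow> nat \<Rightarrow> real"
  assumes "c \<in> {forgotten, inv_deg, zagreb1, ln_zagreb2, ln_zagreb3, m_zagreb}"
  shows "{G :: 'a pair_pre_digraph. extremal (topological_index c) G} = F1 \<union> F3 \<union> F5"
proof -
  obtain g where "\<And>i j. c i j = g i + g j" "g 1 - 4 * g 2 + 3 * g 3 \<noteq> 0"
    by (rule index_vertex_weights[OF assms]) (rule that)
  note extremal_iff = extremal_iff_leaf_count[OF this]
  have "extremal (topological_index c) G \<longleftrightarrow> G \<in> F1 \<union> F3 \<union> F5" for G :: "'a pair_pre_digraph"
  proof (cases "chemical_graph G")
    case True
    then show ?thesis
      using extremal_iff max_leaves_iff[OF True] min_leaves_iff[OF True]
        F1_F3_iff[OF True] F5_iff[OF True]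
      by blast
  next
    case False
    then show ?thesis by (simp add: extremal_iff F1_def F3_def F5_def)
  qed
  then show ?thesis by blast
qed

end
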